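(* Let $p,q\in[1,+\infty)$, and let $E$ be a Banach space when $p=1$, and a normed space when $p>1$. Let $f\colon E\to E$ and assume that the composition operator $C_f$ maps $bv_p(E)$ into $bv_q(E)$. Then $C_f\colon bv_p(E)\to bv_q(E)$ is locally compact if and only if $f$ is a constant map.
   Context: $E$ is over $\mathbb R$ or $\mathbb C$ with norm $\|\cdot\|$. For a map $f\colon E\to E$, the composition operator $C_f$ assigns to a sequence $x\colon\mathbb N\to E$ the sequence $C_f(x)$ with $C_f(x)(n)=f(x(n))$ for all $n\in\mathbb N$. For $p\in[1,+\infty)$, $bv_p(E)$ is the space of all sequences $x\colon\mathbb N\to E$ with $\sum_{n=1}^\infty\|x(n+1)-x(n)\|^p<+\infty$, with norm $\|x\|_{bv_p}=\|x(1)\|+\bigl(\sum_{n=1}^\infty\|x(n+1)-x(n)\|^p\bigr)^{1/p}$. A (not necessarily linear or continuous) map $F\colon X\to Y$ between normed spaces is locally compact if for every bounded subset $B$ of $X$ the image $F(B)$ is contained in a compact subset of $Y$. *)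

theory Defs
  imports "HOL-Analysis.Analysis"
begin

text \<open>Sequences are functions on \<^typ>\<open>nat\<close>, so the first term is \<open>x 0\<close>, where the usual notation,
  with sequences indexed from one, has \<open>x(1)\<close>.\<close>

definition bv_space :: "real \<Rightarrow> (nat \<Rightarrow> 'a::real_normed_vector) set" where
  "bv_space p = {x. summable (\<lambda>n. norm (x (Suc n) - x n) powr p)}"

definition bv_norm :: "real \<Rightarrow> (nat \<Rightarrow> 'a::real_normed_vector) \<Rightarrow> real" where
  "bv_norm p x = norm (x 0) + (\<Sum>n. norm (x (Suc n) - x n) powr p) powr (1 / p)"

definition bv_dist :: "real \<Rightarrow> (nat \<Rightarrow> 'a::real_normed_vector) \<Rightarrow> (nat \<Rightarrow> 'a) \<Rightarrow> real" where
  "bv_dist p x y = bv_norm p (\<lambda>n. x n - y n)"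

definition composition_operator :: "('a \<Rightarrow> 'a) \<Rightarrow> (nat \<Rightarrow> 'a) \<Rightarrow> (nat \<Rightarrow> 'a)" where
  "composition_operator f x = (\<lambda>n. f (x n))"

text \<open>A map \<open>F\<close> from the metric space \<open>(X, d)\<close> to the metric space \<open>(Y, e)\<close>; only the values of
  \<open>F\<close> on \<open>X\<close> matter. Note that \<^const>\<open>Metric_space.mbounded\<close> includes \<open>B \<subseteq> X\<close>.\<close>

definition locally_compact_map ::
  "'a set \<Rightarrow> ('a \<Rightarrow> 'a \<Rightarrow> real) \<Rightarrow> 'b set \<Rightarrow> ('b \<Rightarrow> 'b \<Rightarrow> real) \<Rightarrow> ('a \<Rightarrow> 'b) \<Rightarrow> bool" where
  "locally_compact_map X d Y e F \<longleftrightarrow>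
     (\<forall>B. Metric_space.mbounded X d B \<longrightarrow>
        (\<exists>K. compactin (Metric_space.mtopology Y e) K \<and> F ` B \<subseteq> K))"

text \<open>Minkowski's inequality, needed for \<^const>\<open>bv_dist\<close> to be a metric on \<^const>\<open>bv_space\<close>.\<close>

lemma powr_convex_nonneg:
  fixes p u v t :: real
  assumes p: "p \<ge> 1" and u: "u \<ge> 0" and v: "v \<ge> 0" and t: "0 \<le> t" "t \<le> 1"
  shows "((1 - t) * u + t * v) powr p \<le> (1 - t) * u powr p + t * v powr p"
proof -
  have scale: "(s * w) powr p \<le> s * w powr p" if "0 \<le> s" "s \<le> 1" "0 \<le> w" for s w :: real
  proof -
    have "s powr p \<le> s"
    proof (cases "s = 0")
      case False
      then have "s powr p \<le> s powr 1" using that p by (intro powr_mono') auto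
      then show ?thesis using that False by simp
    qed simp
    then show ?thesis using that by (simp add: powr_mult mult_right_mono)
  qed
  show ?thesis
  proof (cases "u = 0 \<or> v = 0")
    case True
    then show ?thesis using scale[of t v] scale[of "1 - t" u] t u v by auto
  next
    case False
    then show ?thesis
      using convex_onD[OF powr_convex[OF p], of t u v] u v t by simp
  qed
qed

lemma powr_sum_le:
  fixes p a b \<alpha> \<beta> :: real
  assumes p: "p \<ge> 1" and a: "a \<ge> 0" and b: "b \<ge> 0" and pos: "\<alpha> > 0" "\<beta> > 0"
  shows "(a + b) powr p \<le> (\<alpha> + \<beta>) powr p *
           (\<alpha> / (\<alpha> + \<beta>) * (a powr p / \<alpha> powr p) + \<beta> / (\<alpha> + \<beta>) * (b powr p / \<beta> powr p))"
proof -
  define t where "t = \<beta> / (\<alpha> + \<beta>)"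
  have t: "0 \<le> t" "t \<le> 1" "1 - t = \<alpha> / (\<alpha> + \<beta>)"
    using pos by (auto simp: t_def field_simps)
  have "(\<alpha> + \<beta>) * (1 - t) = \<alpha>" "(\<alpha> + \<beta>) * t = \<beta>"
    unfolding t(3) unfolding t_def using pos by simp_all
  then have "a + b = ((\<alpha> + \<beta>) * (1 - t)) * (a / \<alpha>) + ((\<alpha> + \<beta>) * t) * (b / \<beta>)"
    using pos by simp
  then have "a + b = (\<alpha> + \<beta>) * ((1 - t) * (a / \<alpha>) + t * (b / \<beta>))"
    by (simp only: distrib_left mult.assoc)
  then have "(a + b) powr p = (\<alpha> + \<beta>) powr p * ((1 - t) * (a / \<alpha>) + t * (b / \<beta>)) powr p"
    using pos a b t by (simp add: powr_mult)
  also have "\<dots> \<le> (\<alpha> + \<beta>) powr p * ((1 - t) * (a / \<alpha>) powr p + t * (b / \<beta>) powr p)"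
    using pos a b t p by (intro mult_left_mono powr_convex_nonneg) auto
  finally show ?thesis
    unfolding t(3) using pos a b by (simp add: powr_divide t_def)
qed

lemma Minkowski_suminf:
  fixes a b :: "nat \<Rightarrow> real"
  assumes p: "p \<ge> 1" and a: "\<And>n. a n \<ge> 0" and b: "\<And>n. b n \<ge> 0"
    and sa: "summable (\<lambda>n. a n powr p)" and sb: "summable (\<lambda>n. b n powr p)"
  shows "summable (\<lambda>n. (a n + b n) powr p)"
    and "(\<Sum>n. (a n + b n) powr p) powr (1 / p)
           \<le> (\<Sum>n. a n powr p) powr (1 / p) + (\<Sum>n. b n powr p) powr (1 / p)"
proof -
  define A where "A = (\<Sum>n. a n powr p) powr (1 / p)"
  define B where "B = (\<Sum>n. b n powr p) powr (1 / p)"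
  have AB: "A \<ge> 0" "B \<ge> 0" by (auto simp: A_def B_def)
  have Sa: "(\<Sum>n. a n powr p) = A powr p" and Sb: "(\<Sum>n. b n powr p) = B powr p"
    using p suminf_nonneg[OF sa] suminf_nonneg[OF sb] by (auto simp: A_def B_def powr_powr)
  let ?g = "\<lambda>\<alpha> \<beta> n. (\<alpha> + \<beta>) powr p *
           (\<alpha> / (\<alpha> + \<beta>) * (a n powr p / \<alpha> powr p) + \<beta> / (\<alpha> + \<beta>) * (b n powr p / \<beta> powr p))"
  have sg: "summable (?g \<alpha> \<beta>)" for \<alpha> \<beta>
    by (intro summable_mult summable_add summable_divide sa sb)
  show sab: "summable (\<lambda>n. (a n + b n) powr p)"
    by (rule summable_comparison_test'[OF sg[of 1 1], of 0])
       (use powr_sum_le[OF p a b, of 1 1] in auto)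
  have bound: "(\<Sum>n. (a n + b n) powr p) powr (1 / p) \<le> \<alpha> + \<beta>"
    if "\<alpha> > A" "\<beta> > B" for \<alpha> \<beta>
  proof -
    have pos: "\<alpha> > 0" "\<beta> > 0" using AB that by auto
    have le: "A powr p / \<alpha> powr p \<le> 1" "B powr p / \<beta> powr p \<le> 1"
      using that AB pos p by (auto simp: powr_mono2)
    have "(\<Sum>n. (a n + b n) powr p) \<le> (\<Sum>n. ?g \<alpha> \<beta> n)"
      by (intro suminf_le sab sg powr_sum_le p a b pos)
    also have "\<dots> = (\<alpha> + \<beta>) powr p *
        (\<alpha> / (\<alpha> + \<beta>) * (A powr p / \<alpha> powr p) + \<beta> / (\<alpha> + \<beta>) * (B powr p / \<beta> powr p))"
    proof -
      have "?g \<alpha> \<beta> sums ((\<alpha> + \<beta>) powr p *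
        (\<alpha> / (\<alpha> + \<beta>) * (A powr p / \<alpha> powr p) + \<beta> / (\<alpha> + \<beta>) * (B powr p / \<beta> powr p)))"
        using summable_sums[OF sa] summable_sums[OF sb] unfolding Sa Sb
        by (intro sums_mult sums_add sums_divide)
      then show ?thesis by (simp add: sums_iff)
    qed
    also have "\<dots> \<le> (\<alpha> + \<beta>) powr p * (\<alpha> / (\<alpha> + \<beta>) * 1 + \<beta> / (\<alpha> + \<beta>) * 1)"
      using pos by (intro mult_left_mono add_mono le) auto
    also have "\<dots> = (\<alpha> + \<beta>) powr p"
      using pos by (simp flip: add_divide_distrib)
    finally have "(\<Sum>n. (a n + b n) powr p) powr (1 / p) \<le> ((\<alpha> + \<beta>) powr p) powr (1 / p)"
      using p suminf_nonneg[OF sab] by (intro powr_mono2) auto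
    then show ?thesis using pos p by (simp add: powr_powr)
  qed
  show "(\<Sum>n. (a n + b n) powr p) powr (1 / p)
           \<le> (\<Sum>n. a n powr p) powr (1 / p) + (\<Sum>n. b n powr p) powr (1 / p)"
    unfolding A_def[symmetric] B_def[symmetric]
  proof (rule field_le_epsilon)
    fix e :: real assume "e > 0"
    then show "(\<Sum>n. (a n + b n) powr p) powr (1 / p) \<le> A + B + e"
      using bound[of "A + e / 2" "B + e / 2"] by simp
  qed
qed

lemma bv_add:
  fixes x y :: "nat \<Rightarrow> 'a::real_normed_vector"
  assumes p: "p \<ge> 1" and x: "x \<in> bv_space p" and y: "y \<in> bv_space p"
  shows "(\<lambda>n. x n + y n) \<in> bv_space p"
    and "bv_norm p (\<lambda>n. x n + y n) \<le> bv_norm p x + bv_norm p y"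
proof -
  let ?a = "\<lambda>n. norm (x (Suc n) - x n)" and ?b = "\<lambda>n. norm (y (Suc n) - y n)"
  let ?c = "\<lambda>n. norm ((x (Suc n) + y (Suc n)) - (x n + y n))"
  have s: "summable (\<lambda>n. ?a n powr p)" "summable (\<lambda>n. ?b n powr p)"
    using x y by (auto simp: bv_space_def)
  note M = Minkowski_suminf[OF p norm_ge_zero norm_ge_zero s]
  have le: "?c n powr p \<le> (?a n + ?b n) powr p" for n
    using p by (intro powr_mono2) (auto simp: add_diff_add norm_triangle_ineq)
  have sc: "summable (\<lambda>n. ?c n powr p)"
    by (rule summable_comparison_test'[OF M(1), of 0]) (use le in auto)
  then show "(\<lambda>n. x n + y n) \<in> bv_space p" by (simp add: bv_space_def)
  have "(\<Sum>n. ?c n powr p) \<le> (\<Sum>n. (?a n + ?b n) powr p)"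
    by (intro suminf_le le sc M(1))
  then have "(\<Sum>n. ?c n powr p) powr (1 / p) \<le> (\<Sum>n. (?a n + ?b n) powr p) powr (1 / p)"
    using p suminf_nonneg[OF sc] by (intro powr_mono2) auto
  then show "bv_norm p (\<lambda>n. x n + y n) \<le> bv_norm p x + bv_norm p y"
    using M(2) norm_triangle_ineq[of "x 0" "y 0"] unfolding bv_norm_def by linarith
qed

lemma bv_uminus:
  fixes x :: "nat \<Rightarrow> 'a::real_normed_vector"
  shows "(\<lambda>n. - x n) \<in> bv_space p \<longleftrightarrow> x \<in> bv_space p"
    and "bv_norm p (\<lambda>n. - x n) = bv_norm p x"
proof -
  have "norm (- x (Suc n) - - x n) = norm (x (Suc n) - x n)" for n
    by (simp add: norm_minus_commute)
  then show "(\<lambda>n. - x n) \<in> bv_space p \<longleftrightarrow> x \<in> bv_space p"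
    and "bv_norm p (\<lambda>n. - x n) = bv_norm p x"
    unfolding bv_space_def bv_norm_def by (simp_all only: mem_Collect_eq norm_minus_cancel)
qed

lemma bv_diff:
  assumes "p \<ge> 1" "x \<in> bv_space p" "y \<in> bv_space p"
  shows "(\<lambda>n. x n - y n) \<in> bv_space p"
  using bv_add(1)[of p x "\<lambda>n. - y n"] assms by (simp add: bv_uminus)

lemma bv_norm_eq_0:
  assumes p: "p \<ge> 1" and x: "x \<in> bv_space p"
  shows "bv_norm p x = 0 \<longleftrightarrow> (\<forall>n. x n = 0)"
proof
  assume z: "bv_norm p x = 0"
  have s: "summable (\<lambda>n. norm (x (Suc n) - x n) powr p)"
    using x by (simp add: bv_space_def)
  have "norm (x 0) \<ge> 0" "(\<Sum>n. norm (x (Suc n) - x n) powr p) powr (1 / p) \<ge> 0" by auto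
  with z have z: "x 0 = 0" "(\<Sum>n. norm (x (Suc n) - x n) powr p) = 0"
    unfolding bv_norm_def by (auto simp: add_nonneg_eq_0_iff)
  then have "x (Suc n) = x n" for n
    using suminf_eq_zero_iff[OF s] by auto
  then have "x n = 0" for n
    by (induction n) (auto simp: z)
  then show "\<forall>n. x n = 0" by simp
next
  assume "\<forall>n. x n = 0"
  then show "bv_norm p x = 0" by (simp add: bv_norm_def)
qed

lemma Metric_space_bv:
  assumes p: "p \<ge> 1"
  shows "Metric_space (bv_space p :: (nat \<Rightarrow> 'a::real_normed_vector) set) (bv_dist p)"
proof
  fix x y z :: "nat \<Rightarrow> 'a"
  show "0 \<le> bv_dist p x y" by (simp add: bv_dist_def bv_norm_def)
  show "bv_dist p x y = bv_dist p y x"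
    using bv_uminus(2)[of p "\<lambda>n. x n - y n"] by (simp add: bv_dist_def)
  assume x: "x \<in> bv_space p" and y: "y \<in> bv_space p"
  show "bv_dist p x y = 0 \<longleftrightarrow> x = y"
    using bv_norm_eq_0[OF p bv_diff[OF p x y]] by (auto simp: bv_dist_def)
  assume z: "z \<in> bv_space p"
  show "bv_dist p x z \<le> bv_dist p x y + bv_dist p y z"
    using bv_add(2)[OF p bv_diff[OF p x y] bv_diff[OF p y z]] by (simp add: bv_dist_def)
qed

end

(* If f a and f b differ, the sequences jumping once from a to b at varying times form a bounded set, while
   their images under the composition operator are uniformly separated: the difference of two of
   them still has a jump of size norm (f b - f a). *)
theory Submission
  imports Defs
begin

text \<open>With \<open>n \<le> i\<close> rather than \<open>n < i\<close>, the only increment that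
  can be nonzero is the one with index \<open>i\<close>, and the first term is always
  \<open>a\<close>.\<close>

definition step_seq :: "'a \<Rightarrow> 'a \<Rightarrow> nat \<Rightarrow> nat \<Rightarrow> 'a" where
  "step_seq a b i n = (if n \<le> i then a else b)"

lemma step_seq_increment_powr:
  fixes a b :: "'a::real_normed_vector"
  assumes "p \<ge> 1"
  shows "norm (step_seq a b i (Suc n) - step_seq a b i n) powr p
           = (if n = i then norm (b - a) powr p else 0)"
  using assms by (auto simp: step_seq_def)

lemma step_seq_in_bv_space:
  fixes a b :: "'a::real_normed_vector"
  assumes "p \<ge> 1"
  shows "step_seq a b i \<in> bv_space p"
  unfolding bv_space_def mem_Collect_eq step_seq_increment_powr[OF assms]
  by (rule summable_single)

text \<open>Only one increment contributes to the series, and the outer root undoes its power. The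
  value does not depend on \<open>i\<close>, so moving the jump keeps the family bounded.\<close>

lemma bv_norm_step_seq:
  fixes a b :: "'a::real_normed_vector"
  assumes "p \<ge> 1"
  shows "bv_norm p (step_seq a b i) = norm a + norm (b - a)"
proof -
  have "(\<Sum>n. norm (step_seq a b i (Suc n) - step_seq a b i n) powr p) = norm (b - a) powr p"
    unfolding step_seq_increment_powr[OF assms]
    using sums_single[of i "\<lambda>_. norm (b - a) powr p"] by (simp add: sums_iff)
  then show ?thesis
    using assms by (simp add: bv_norm_def powr_powr step_seq_def)
qed

text \<open>Step sequences are mapped to step sequences with the same jump index, so the same
  estimates serve the domain with \<open>p\<close> and the codomain with \<open>q\<close>.\<close>

lemma composition_operator_step_seq:
  "composition_operator f (step_seq a b i) = step_seq (f a) (f b) i"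
  by (auto simp: composition_operator_def step_seq_def)

lemma const_in_bv_space:
  "(\<lambda>_. c) \<in> bv_space p"
  by (simp add: bv_space_def)

text \<open>One term of a nonnegative series is at most its sum. This allows a distance to be
  bounded from below by inspecting a single index.\<close>

lemma norm_increment_le_bv_norm:
  fixes x :: "nat \<Rightarrow> 'a::real_normed_vector"
  assumes p: "p \<ge> 1" and x: "x \<in> bv_space p"
  shows "norm (x (Suc n) - x n) \<le> bv_norm p x"
proof -
  let ?d = "\<lambda>n. norm (x (Suc n) - x n) powr p"
  have s: "summable ?d"
    using x by (simp add: bv_space_def)
  have "?d n \<le> suminf ?d"
    using sum_le_suminf[OF s, of "{n}"] by simp
  then have "?d n powr (1 / p) \<le> suminf ?d powr (1 / p)"
    using p by (intro powr_mono2) auto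
  then show ?thesis
    using p by (simp add: bv_norm_def powr_powr add_increasing)
qed

lemma bv_dist_step_seq_ge:
  fixes a b :: "'a::real_normed_vector"
  assumes p: "p \<ge> 1" and "i \<noteq> j"
  shows "norm (b - a) \<le> bv_dist p (step_seq a b i) (step_seq a b j)"
proof -
  let ?x = "\<lambda>n. step_seq a b i n - step_seq a b j n"
  have "?x \<in> bv_space p"
    by (intro bv_diff step_seq_in_bv_space p)
  \<comment> \<open>Between \<open>i\<close> and \<open>Suc i\<close> the first sequence jumps,
    while the second is constant because its jump is at \<open>j\<close>.\<close>
  moreover have "norm (?x (Suc i) - ?x i) = norm (b - a)"
    using \<open>i \<noteq> j\<close> by (auto simp: step_seq_def)
  ultimately show ?thesis
    using norm_increment_le_bv_norm[OF p, of ?x i] by (simp add: bv_dist_def)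
qed

text \<open>A convergent subsequence has two distinct terms within \<open>\<epsilon> / 2\<close> of
  its limit, against the separation. Concluding \<open>\<epsilon> \<le> 0\<close> lets
  \<open>\<epsilon>\<close> be a norm that is then forced to vanish.\<close>

lemma (in Metric_space) compactin_separation_nonpos:
  assumes K: "compactin mtopology K" and \<sigma>: "range \<sigma> \<subseteq> K"
    and sep: "\<And>i j::nat. i \<noteq> j \<Longrightarrow> \<epsilon> \<le> d (\<sigma> i) (\<sigma> j)"
  shows "\<epsilon> \<le> 0"
proof (rule ccontr)
  assume "\<not> \<epsilon> \<le> 0"
  then have "\<epsilon> / 2 > 0" by simp
  obtain l r where r: "strict_mono r" and lim: "limitin mtopology (\<sigma> \<circ> r) l sequentially"
    using iffD1[OF compactin_sequentially K, THEN conjunct2, rule_format, OF \<sigma>] by blast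
  obtain N where N: "\<And>n. n \<ge> N \<Longrightarrow> (\<sigma> \<circ> r) n \<in> M \<and> d ((\<sigma> \<circ> r) n) l < \<epsilon> / 2"
    using lim \<open>\<epsilon> / 2 > 0\<close> unfolding limit_metric_sequentially by blast
  have "l \<in> M"
    using lim by (simp add: limit_metric_sequentially)
  then have "d (\<sigma> (r N)) (\<sigma> (r (Suc N))) \<le> d (\<sigma> (r N)) l + d (\<sigma> (r (Suc N))) l"
    using N[of N] N[of "Suc N"] triangle''[of "\<sigma> (r N)" l "\<sigma> (r (Suc N))"]
    by (simp add: commute)
  also have "\<dots> < \<epsilon>"
    using N[of N] N[of "Suc N"] by simp
  also have "\<epsilon> \<le> d (\<sigma> (r N)) (\<sigma> (r (Suc N)))"
    by (rule sep) (use strict_mono_eq[OF r] in simp)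
  finally show False by simp
qed

theorem theorem42:
  fixes f :: "'a::real_normed_vector \<Rightarrow> 'a" and p q :: real
  assumes "1 \<le> p" and "1 \<le> q"
    and "p = 1 \<Longrightarrow> complete (UNIV :: 'a set)"
    and "composition_operator f ` bv_space p \<subseteq> bv_space q"
  shows "locally_compact_map (bv_space p) (bv_dist p) (bv_space q) (bv_dist q) (composition_operator f)
           \<longleftrightarrow> f constant_on UNIV"
proof -
  interpret P: Metric_space "bv_space p :: (nat \<Rightarrow> 'a) set" "bv_dist p"
    by (rule Metric_space_bv) fact
  interpret Q: Metric_space "bv_space q :: (nat \<Rightarrow> 'a) set" "bv_dist q"
    by (rule Metric_space_bv) fact
  show ?thesis
  proof
    assume L: "locally_compact_map (bv_space p) (bv_dist p) (bv_space q) (bv_dist q)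
                 (composition_operator f)"
    have "f a = f b" for a b
    proof -
      \<comment> \<open>The zero sequence is the centre of a ball containing all the step sequences;
        the distance to it is the norm of the negated sequence.\<close>
      have "bv_dist p (\<lambda>_. 0) (step_seq a b i) \<le> norm a + norm (b - a)" for i
        using bv_uminus(2)[of p "step_seq a b i"] bv_norm_step_seq[OF \<open>1 \<le> p\<close>, of a b i]
        by (simp add: bv_dist_def)
      then have "P.mbounded (range (step_seq a b))"
        unfolding P.mbounded_def
        by (intro exI[of _ "\<lambda>_. 0"] exI[of _ "norm a + norm (b - a)"])
           (auto simp: const_in_bv_space step_seq_in_bv_space \<open>1 \<le> p\<close>)
      then obtain K where K: "compactin Q.mtopology K"
        and sub: "composition_operator f ` range (step_seq a b) \<subseteq> K"
        using L unfolding locally_compact_map_def by meson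
      have "range (step_seq (f a) (f b)) \<subseteq> K"
        using sub by (simp add: image_image composition_operator_step_seq)
      then have "norm (f b - f a) \<le> 0"
        by (rule Q.compactin_separation_nonpos[OF K])
           (rule bv_dist_step_seq_ge[OF \<open>1 \<le> q\<close>])
      then show ?thesis by simp
    qed
    then show "f constant_on UNIV"
      unfolding constant_on_def by blast
  next
    assume "f constant_on UNIV"
    then obtain c where "\<And>x. f x = c"
      by (auto simp: constant_on_def)
    \<comment> \<open>Every set, bounded or not, is sent into one singleton, which is
      compact.\<close>
    then have "composition_operator f ` B \<subseteq> {\<lambda>_. c}" for B
      by (auto simp: composition_operator_def)
    moreover have "compactin Q.mtopology {\<lambda>_. c}"
      by (simp add: const_in_bv_space)
    ultimately show "locally_compact_map (bv_space p) (bv_dist p) (bv_space q) (bv_dist q)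
                       (composition_operator f)"
      unfolding locally_compact_map_def by blast
  qed
qed

end
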